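(* Let $\mathbb{K}\in\{\mathbb{R},\mathbb{C}\}$. Let $Y$ be a compact Hausdorff space, and let $\chi:Y\to Y$ be a surjective homeomorphism such that: (1) there is a point $1_Y\in Y$ with $\{\chi^n(1_Y):n\in\mathbb{N}\}$ dense in $Y$; (2) there is a point $0_Y\in Y\setminus\{1_Y\}$ which is periodic for $\chi$, of prime (i.e. least) period $N\in\mathbb{N}$. Let $\delta_1,\delta_2\in\mathbb{K}\setminus\{0\}$ satisfy $|\delta_1|+|\delta_2|\le1$ and $(\delta_1+\delta_2)^N\ne1$. Let $X=Y\cup\mathcal{N}$, $\phi:X\setminus\{\mathbf{1}\}\to X$ and $T=T[1,\phi,\Delta]:C(X)\to C(X)$ be the compact space, the homeomorphism and the operator constructed from these data in the context. Then $T$ is an isometric shift of type $\mathrm{I}_0$.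
   Context: Construction. Put $0_Y^k:=\chi^k(0_Y)$ for $k=0,\dots,N-1$. Let $\mathcal{N}=\{\mathbf{1},\mathbf{2},\mathbf{3},\dots\}$ be a countably infinite discrete space, let $\mathcal{N}_k:=\{\mathbf{n}\in\mathcal{N}:n\equiv k\bmod N\}$ and let $\mathcal{N}_k\cup\{\infty_k\}$ be its one-point compactification, $k=0,\dots,N-1$. Let $X$ be the union of $Y$ and the topological sum $\mathcal{N}\cup\{\infty_0,\dots,\infty_{N-1}\}$ of these one-point compactifications, where $\infty_k$ is identified with the point $0_Y^k\in Y$ for each $k$ (quotient of the topological sum). Let $\phi:X\setminus\{\mathbf{1}\}\to X$ be the homeomorphism with $\phi:=\chi^{-1}$ on $Y$ and $\phi(\mathbf{n+1}):=\mathbf{n}$ for $n\in\mathbb{N}$. Define $\Delta(f):=\delta_1f(1_Y)+\delta_2f(\chi^N(1_Y))$ for $f\in C(X)$. The operator $T=T[1,\phi,\Delta]:C(X)\to C(X)$ is given by $(Tf)(x):=f(\phi(x))$ for $x\ne\mathbf{1}$ and $(Tf)(\mathbf{1}):=\Delta(f)$. Shifts. For compact Hausdorff $X$, $C(X)$ is the Banach space of $\mathbb{K}$-valued continuous functions on $X$ with the supremum norm. An isometric shift on a Banach space $E$ is a linear isometry $T:E\to E$ with $T(E)$ of codimension $1$ and $\bigcap_{n\ge1}T^n(E)=\{0\}$. An isometric shift $T$ on $C(X)$ is of type $\mathrm{I}$ if there are an isolated point $p\in X$, a homeomorphism $\phi$ from $X\setminus\{p\}$ onto $X$ and $a\in C(X\setminus\{p\})$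 with $|a|\equiv1$ such that $(Tf)(x)=a(x)f(\phi(x))$ for all $x\ne p$ and $f\in C(X)$. It is of type $\mathrm{II}$ if there are a continuous surjection $\phi:X\to X$ and $a\in C(X)$, $|a|\equiv1$, with $(Tf)(x)=a(x)f(\phi(x))$ for all $x\in X$ and $f\in C(X)$. It is of type $\mathrm{I}_0$ if it is of type $\mathrm{I}$ and not of type $\mathrm{II}$.
   Formalization: Type I_0 is claimed only if Y is infinite or |δ1+δ2|≠1: for finite Y (a single N-cycle, so χ^N(1_Y)=1_Y) with |δ1+δ2|=1, T is also of type II (e.g. Y=Z/3, δ1=δ2=-1/2). That T is an isometric shift of type I is shown in all cases. *)

theory Defs
  imports "HOL-Analysis.Analysis" "HOL-Library.Function_Algebras"
begin

subsection \<open>Binary topological sums and quotient topologies\<close>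

definition binary_sum_topology :: "'a topology \<Rightarrow> 'b topology \<Rightarrow> ('a + 'b) topology" where
  "binary_sum_topology A B =
     topology (\<lambda>U. openin A (Inl -` U) \<and> openin B (Inr -` U))"

lemma openin_binary_sum_topology:
  "openin (binary_sum_topology A B) U \<longleftrightarrow> openin A (Inl -` U) \<and> openin B (Inr -` U)"
proof -
  have "istopology (\<lambda>U. openin A (Inl -` U) \<and> openin B (Inr -` U))"
    unfolding istopology_def by (auto simp: vimage_Int vimage_Union)
  then show ?thesis
    by (simp add: binary_sum_topology_def)
qed

lemma topspace_binary_sum_topology [simp]:
  "topspace (binary_sum_topology A B) = topspace A <+> topspace B"
proof
  have "Inl -` topspace (binary_sum_topology A B) \<subseteq> topspace A"
       "Inr -` topspace (binary_sum_topology A B) \<subseteq> topspace B"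
    using openin_binary_sum_topology [of A B "topspace (binary_sum_topology A B)"]
    by (auto dest: openin_subset)
  then show "topspace (binary_sum_topology A B) \<subseteq> topspace A <+> topspace B"
    by (auto simp: Plus_def) (metis obj_sumE rev_image_eqI subsetD vimageI2)
  have "Inl -` (topspace A <+> topspace B) = topspace A"
       "Inr -` (topspace A <+> topspace B) = topspace B"
    by auto
  then have "openin (binary_sum_topology A B) (topspace A <+> topspace B)"
    by (simp add: openin_binary_sum_topology)
  then show "topspace A <+> topspace B \<subseteq> topspace (binary_sum_topology A B)"
    by (rule openin_subset)
qed

definition quotient_topology :: "'a topology \<Rightarrow> ('a \<Rightarrow> 'b) \<Rightarrow> 'b topology" where
  "quotient_topology S q =
     topology (\<lambda>U. U \<subseteq> q ` topspace S \<and> openin S {x \<in> topspace S. q x \<in> U})"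

lemma openin_quotient_topology:
  "openin (quotient_topology S q) U \<longleftrightarrow>
     U \<subseteq> q ` topspace S \<and> openin S {x \<in> topspace S. q x \<in> U}"
proof -
  have 1: "{x \<in> topspace S. q x \<in> U \<inter> V} =
      {x \<in> topspace S. q x \<in> U} \<inter> {x \<in> topspace S. q x \<in> V}" for U V
    by auto
  have 2: "{x \<in> topspace S. q x \<in> \<Union>K} = (\<Union>U\<in>K. {x \<in> topspace S. q x \<in> U})" for K
    by auto
  have "istopology (\<lambda>U. U \<subseteq> q ` topspace S \<and> openin S {x \<in> topspace S. q x \<in> U})"
    unfolding istopology_def 1 2 by blast
  then show ?thesis
    by (simp add: quotient_topology_def)
qed

lemma topspace_quotient_topology [simp]: "topspace (quotient_topology S q) = q ` topspace S"
proof
  show "topspace (quotient_topology S q) \<subseteq> q ` topspace S"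
    using openin_quotient_topology [of S q "topspace (quotient_topology S q)"] by simp
  have "{x \<in> topspace S. q x \<in> q ` topspace S} = topspace S"
    by auto
  then have "openin (quotient_topology S q) (q ` topspace S)"
    by (simp add: openin_quotient_topology)
  then show "q ` topspace S \<subseteq> topspace (quotient_topology S q)"
    by (rule openin_subset)
qed

lemma quotient_map_quotient_topology: "quotient_map S (quotient_topology S q) q"
  by (simp add: quotient_map_def openin_quotient_topology)


subsection \<open>Spaces of continuous functions\<close>

text \<open>
  An element of C(X) is represented by its extension by zero to the whole type, so that C(X) is a
  linear subspace of the space of all functions, with pointwise operations.
\<close>

definition cfun_space :: "'x topology \<Rightarrow> ('x \<Rightarrow> 'k::real_normed_field) set" where
  "cfun_space X = {f. continuous_map X euclidean f \<and> (\<forall>x. x \<notin> topspace X \<longrightarrow> f x = 0)}"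

definition sup_norm :: "'x topology \<Rightarrow> ('x \<Rightarrow> 'k::real_normed_field) \<Rightarrow> real" where
  "sup_norm X f = (SUP x\<in>topspace X. norm (f x))"

definition fun_scale :: "'k::real_normed_field \<Rightarrow> ('x \<Rightarrow> 'k) \<Rightarrow> 'x \<Rightarrow> 'k" where
  "fun_scale c f = (\<lambda>x. c * f x)"

lemma vector_space_fun_scale: "vector_space fun_scale"
  by standard (auto simp: fun_scale_def fun_eq_iff algebra_simps)


subsection \<open>Isometric shifts\<close>

text \<open>
  Codimension of \<open>W\<close> in \<open>E\<close>, with respect to the scalar multiplication \<open>smul\<close>, as the dimension of
  an algebraic complement of \<open>W\<close> in \<open>E\<close>.
\<close>

definition has_codim ::
  "('k::field \<Rightarrow> 'v::ab_group_add \<Rightarrow> 'v) \<Rightarrow> 'v set \<Rightarrow> 'v set \<Rightarrow> nat \<Rightarrow> bool" where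
  "has_codim smul W E n \<longleftrightarrow> W \<subseteq> E \<and>
     (\<exists>B\<subseteq>E. finite B \<and> card B = n \<and> \<not> module.dependent smul B \<and>
        W \<inter> module.span smul B = {0} \<and>
        (\<forall>e\<in>E. \<exists>w\<in>W. \<exists>b\<in>module.span smul B. e = w + b))"

definition isometric_shift ::
  "('k::real_normed_field \<Rightarrow> 'v::ab_group_add \<Rightarrow> 'v) \<Rightarrow> 'v set \<Rightarrow> ('v \<Rightarrow> real) \<Rightarrow> ('v \<Rightarrow> 'v) \<Rightarrow> bool"
where
  "isometric_shift smul E nrm T \<longleftrightarrow>
     T \<in> E \<rightarrow> E \<and>
     (\<forall>f\<in>E. \<forall>g\<in>E. T (f + g) = T f + T g) \<and>
     (\<forall>c. \<forall>f\<in>E. T (smul c f) = smul c (T f)) \<and>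
     (\<forall>f\<in>E. nrm (T f) = nrm f) \<and>
     has_codim smul (T ` E) E 1 \<and>
     (\<Inter>n\<in>{1..}. (T ^^ n) ` E) = {0}"

definition isometric_shift_C ::
  "'x topology \<Rightarrow> (('x \<Rightarrow> 'k::real_normed_field) \<Rightarrow> 'x \<Rightarrow> 'k) \<Rightarrow> bool" where
  "isometric_shift_C X T \<longleftrightarrow>
     compact_space X \<and> Hausdorff_space X \<and>
     isometric_shift fun_scale (cfun_space X) (sup_norm X) T"

definition type_I ::
  "'x topology \<Rightarrow> (('x \<Rightarrow> 'k::real_normed_field) \<Rightarrow> 'x \<Rightarrow> 'k) \<Rightarrow> bool" where
  "type_I X T \<longleftrightarrow>
     (\<exists>p \<phi> a. p \<in> topspace X \<and> openin X {p} \<and>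
        homeomorphic_map (subtopology X (topspace X - {p})) X \<phi> \<and>
        continuous_map (subtopology X (topspace X - {p})) euclidean a \<and>
        (\<forall>x\<in>topspace X - {p}. norm (a x) = 1) \<and>
        (\<forall>f\<in>cfun_space X. \<forall>x\<in>topspace X - {p}. T f x = a x * f (\<phi> x)))"

definition type_II ::
  "'x topology \<Rightarrow> (('x \<Rightarrow> 'k::real_normed_field) \<Rightarrow> 'x \<Rightarrow> 'k) \<Rightarrow> bool" where
  "type_II X T \<longleftrightarrow>
     (\<exists>\<phi> a. continuous_map X X \<phi> \<and> \<phi> ` topspace X = topspace X \<and>
        continuous_map X euclidean a \<and>
        (\<forall>x\<in>topspace X. norm (a x) = 1) \<and>
        (\<forall>f\<in>cfun_space X. \<forall>x\<in>topspace X. T f x = a x * f (\<phi> x)))"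

definition isometric_shift_type_I0 ::
  "'x topology \<Rightarrow> (('x \<Rightarrow> 'k::real_normed_field) \<Rightarrow> 'x \<Rightarrow> 'k) \<Rightarrow> bool" where
  "isometric_shift_type_I0 X T \<longleftrightarrow> isometric_shift_C X T \<and> type_I X T \<and> \<not> type_II X T"


subsection \<open>The construction\<close>

text \<open>
  The points of \<open>X\<close> are \<open>Inl y\<close> for \<open>y\<close> in \<open>Y\<close>, and \<open>Inr n\<close> with \<open>n \<ge> 1\<close> for the points of the
  countable discrete space. In the sum, \<open>Inr (k, Some n)\<close> is the point \<open>n\<close>, of the residue class
  \<open>k\<close> modulo \<open>N\<close>, and \<open>Inr (k, None)\<close> is the point at infinity of that class.
\<close>

definition residue_class :: "nat \<Rightarrow> nat \<Rightarrow> nat set" where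
  "residue_class N k = {n. 1 \<le> n \<and> n mod N = k}"

definition glue_map ::
  "('y \<Rightarrow> 'y) \<Rightarrow> 'y \<Rightarrow> 'y + nat \<times> nat option \<Rightarrow> 'y + nat" where
  "glue_map chi zeroY p =
     (case p of
        Inl y \<Rightarrow> Inl y
      | Inr (k, None) \<Rightarrow> Inl ((chi ^^ k) zeroY)
      | Inr (k, Some n) \<Rightarrow> Inr n)"

definition shift_space ::
  "'y topology \<Rightarrow> ('y \<Rightarrow> 'y) \<Rightarrow> 'y \<Rightarrow> nat \<Rightarrow> ('y + nat) topology" where
  "shift_space Y chi zeroY N =
     quotient_topology
       (binary_sum_topology Y
          (sum_topology
             (\<lambda>k. Alexandroff_compactification (discrete_topology (residue_class N k))) {..<N}))
       (glue_map chi zeroY)"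

text \<open>The value of \<open>shift_map\<close> at the point \<open>Inr 1\<close>, where the map is not defined, is irrelevant.\<close>

definition shift_map :: "'y topology \<Rightarrow> ('y \<Rightarrow> 'y) \<Rightarrow> 'y + nat \<Rightarrow> 'y + nat" where
  "shift_map Y chi p =
     (case p of
        Inl y \<Rightarrow> Inl (inv_into (topspace Y) chi y)
      | Inr n \<Rightarrow> Inr (n - 1))"

definition shift_functional ::
  "('y \<Rightarrow> 'y) \<Rightarrow> 'y \<Rightarrow> nat \<Rightarrow> 'k::real_normed_field \<Rightarrow> 'k \<Rightarrow> ('y + nat \<Rightarrow> 'k) \<Rightarrow> 'k" where
  "shift_functional chi oneY N \<delta>\<^sub>1 \<delta>\<^sub>2 f = \<delta>\<^sub>1 * f (Inl oneY) + \<delta>\<^sub>2 * f (Inl ((chi ^^ N) oneY))"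

text \<open>The operator \<open>T[a, \<phi>, \<Delta>]\<close> with distinguished isolated point \<open>p\<close>.\<close>

definition shift_operator ::
  "'x topology \<Rightarrow> 'x \<Rightarrow> ('x \<Rightarrow> 'k::real_normed_field) \<Rightarrow> ('x \<Rightarrow> 'x) \<Rightarrow> (('x \<Rightarrow> 'k) \<Rightarrow> 'k)
     \<Rightarrow> ('x \<Rightarrow> 'k) \<Rightarrow> 'x \<Rightarrow> 'k" where
  "shift_operator X p a \<phi> \<Delta> f =
     (\<lambda>x. if x = p then \<Delta> f else if x \<in> topspace X then a x * f (\<phi> x) else 0)"

end

theory Submission
  imports Defs
begin

text \<open>
  The points \<open>n\<close> of the discrete part shadow the periodic orbit: \<open>n\<close> and \<open>\<chi>\<^sup>n(0)\<close> become arbitrarily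
  close, so the topology of \<open>X\<close> can be described without residue classes. If \<open>f\<close> lies in
  the range of every power of \<open>T\<close>, then \<open>f(n) = g(\<chi>\<^sup>n(1))\<close> on the discrete part, where
  \<open>g = \<delta>\<^sub>1 f + \<delta>\<^sub>2 f \<circ> \<chi>\<^sup>N\<close> on \<open>Y\<close>. Hence \<open>g(\<chi>\<^sup>n(1)) - c\<^sub>n \<rightarrow> 0\<close> with the \<open>N\<close>-periodic sequence
  \<open>c\<^sub>n = f(\<chi>\<^sup>n(0))\<close>; as every tail of the orbit of \<open>1\<close> is dense, \<open>g\<close> is \<open>\<chi>\<^sup>N\<close>-invariant, and so
  \<open>g(\<chi>\<^sup>n(1)) = c\<^sub>n\<close> for all \<open>n\<close>. Approximating \<open>0\<close> by points \<open>\<chi>\<^sup>n(1)\<close> with \<open>n \<equiv> r (mod N)\<close> gives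
  \<open>(\<delta>\<^sub>1 + \<delta>\<^sub>2) c\<^sub>k = c\<^bsub>r+k\<^esub>\<close>; \<open>N\<close> such steps return to \<open>c\<^sub>k\<close>, so \<open>c = 0\<close> and \<open>g = 0\<close>. Then
  \<open>|f \<circ> \<chi>\<^sup>N|\<close> is a constant multiple \<open>\<rho>\<close> of \<open>|f|\<close>: if \<open>\<rho> \<noteq> 1\<close>, compare maxima; if \<open>\<rho> = 1\<close>, use again that \<open>f\<close>
  vanishes on the orbit of \<open>0\<close>, which the orbit of \<open>1\<close> approaches.

  \<open>T\<close> is not of type II because \<open>\<Delta>\<close> is not a unimodular multiple of a point evaluation, except when
  \<open>|\<delta>\<^sub>1 + \<delta>\<^sub>2| = 1\<close> and \<open>\<chi>\<^sup>N(1) = 1\<close>; the latter makes \<open>Y\<close> a finite orbit.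
\<close>

subsection \<open>Weighted composition with a distinguished isolated point\<close>

text \<open>A point that is both open and closed splits off as a summand of the space, so continuity
  is decided on its complement.\<close>

lemma continuous_map_isolated_point:
  assumes "openin X {p}" and "closedin X {p}"
    and "continuous_map (subtopology X (topspace X - {p})) Z f" and "f p \<in> topspace Z"
  shows "continuous_map X Z f"
  unfolding continuous_map
proof (intro conjI allI impI)
  let ?S = "subtopology X (topspace X - {p})"
  show "f ` topspace X \<subseteq> topspace Z"
    using continuous_map_image_subset_topspace [OF assms(3)] assms(4) by auto
  fix U assume "openin Z U"
  then have "openin ?S {x \<in> topspace ?S. f x \<in> U}"
    using assms(3) by (simp only: continuous_map)
  moreover have "openin X (topspace X - {p})"
    using assms(2) by blast
  ultimately have "openin X {x \<in> topspace ?S. f x \<in> U}"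
    by (simp add: openin_open_subtopology)
  moreover have "p \<in> topspace X"
    using assms(1) openin_subset by blast
  then have "{x \<in> topspace X. f x \<in> U} =
      {x \<in> topspace ?S. f x \<in> U} \<union> (if f p \<in> U then {p} else {})"
    by auto
  ultimately show "openin X {x \<in> topspace X. f x \<in> U}"
    using assms(1) by (simp add: openin_Un)
qed

section \<open>Norm bounds and separating functions in C(X)\<close>

lemma cfun_space_bounded:
  assumes "compact_space X" and "f \<in> cfun_space X"
  shows "bdd_above ((\<lambda>x. norm (f x)) ` topspace X)"
proof -
  have "compactin euclideanreal ((\<lambda>x. norm (f x)) ` topspace X)"
    using assms by (intro image_compactin[of X])
      (auto simp: compact_space_def cfun_space_def intro: continuous_map_norm)
  then show ?thesis
    by (simp add: bounded_imp_bdd_above compact_imp_bounded)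
qed

lemma norm_le_sup_norm:
  assumes "compact_space X" and "f \<in> cfun_space X" and "x \<in> topspace X"
  shows "norm (f x) \<le> sup_norm X f"
  unfolding sup_norm_def using cfun_space_bounded [OF assms(1,2)] assms(3) by (rule cSUP_upper2) simp

lemma continuous_map_mult_left:
  fixes f :: "'a \<Rightarrow> 'k::real_normed_algebra"
  assumes "continuous_map X euclidean f"
  shows "continuous_map X euclidean (\<lambda>x. c * f x)"
  using assms by (simp add: continuous_map_atin tendsto_mult_left)

lemma zero_cfun_space: "0 \<in> cfun_space X"
  by (simp add: cfun_space_def zero_fun_def)

text \<open>Urysohn's lemma for a finite set and a point outside it, cut off by zero outside the
  space. It serves to tell point evaluations apart when type II is excluded.\<close>

lemma cfun_space_separate:
  assumes "compact_space X" and "Hausdorff_space X"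
    and "finite F" and "F \<subseteq> topspace X" and "x \<in> topspace X - F"
  shows "\<exists>f :: 'x \<Rightarrow> 'k::real_normed_field. f \<in> cfun_space X \<and> f x = 1 \<and> (\<forall>z\<in>F. f z = 0)"
proof -
  have "normal_space X"
    using assms(1,2) by (simp add: compact_Hausdorff_or_regular_imp_normal_space)
  moreover have "closedin X F" "closedin X {x}"
    using assms by (auto intro: closedin_Hausdorff_finite)
  moreover have "disjnt F {x}"
    using assms(5) by auto
  ultimately obtain u where u: "continuous_map X euclideanreal u" "u ` F \<subseteq> {0}" "u ` {x} \<subseteq> {1}"
    by (rule Urysohn_lemma_alt)
  let ?f = "\<lambda>z. if z \<in> topspace X then (of_real (u z) :: 'k) else 0"
  have "continuous_map euclideanreal euclidean (of_real :: real \<Rightarrow> 'k)"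
    by (simp add: continuous_on_of_real_id)
  with u(1) have "continuous_map X euclidean ((of_real :: real \<Rightarrow> 'k) \<circ> u)"
    by (rule continuous_map_compose)
  then have "continuous_map X euclidean ?f"
    by (rule continuous_map_eq) simp
  moreover have "?f x = 1" "\<forall>z\<in>F. ?f z = 0"
    using u(2,3) assms(5) by auto
  ultimately show ?thesis
    unfolding cfun_space_def by (intro exI [of _ ?f]) simp
qed

text \<open>Linearity of \<open>\<Delta>\<close> is demanded on all functions, not only on
  continuous ones: combinations of point evaluations satisfy it, and additivity and homogeneity of
  \<open>T\<close> then need no membership conditions.\<close>

locale isolated_point_shift =
  fixes X :: "'x topology" and p :: 'x and \<phi> :: "'x \<Rightarrow> 'x"
    and \<Delta> :: "('x \<Rightarrow> 'k::real_normed_field) \<Rightarrow> 'k"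
  assumes compact: "compact_space X" and Hausdorff: "Hausdorff_space X"
    and isolated: "openin X {p}"
    and homeo: "homeomorphic_map (subtopology X (topspace X - {p})) X \<phi>"
    and functional_add: "\<Delta> (f + g) = \<Delta> f + \<Delta> g"
    and functional_scale: "\<Delta> (fun_scale c f) = c * \<Delta> f"
    and functional_norm: "f \<in> cfun_space X \<Longrightarrow> norm (\<Delta> f) \<le> sup_norm X f"
begin

abbreviation T :: "('x \<Rightarrow> 'k) \<Rightarrow> 'x \<Rightarrow> 'k" where
  "T \<equiv> shift_operator X p (\<lambda>_. 1) \<phi> \<Delta>"

lemma isolated_in_space: "p \<in> topspace X"
  using isolated openin_subset by blast

lemma isolated_closed: "closedin X {p}"
  using Hausdorff isolated_in_space by (rule closedin_Hausdorff_singleton)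

lemma image_complement: "\<phi> ` (topspace X - {p}) = topspace X"
  using homeomorphic_imp_surjective_map [OF homeo] by (simp add: Int_absorb1)

lemma operator_isolated: "T f p = \<Delta> f"
  by (simp add: shift_operator_def)

lemma operator_off: "x \<in> topspace X - {p} \<Longrightarrow> T f x = f (\<phi> x)"
  by (simp add: shift_operator_def)

lemma operator_closed:
  assumes "f \<in> cfun_space X"
  shows "T f \<in> cfun_space X"
proof -
  let ?S = "subtopology X (topspace X - {p})"
  have "continuous_map ?S euclidean (f \<circ> \<phi>)"
    using homeomorphic_imp_continuous_map [OF homeo] assms
    by (intro continuous_map_compose) (auto simp: cfun_space_def)
  then have "continuous_map ?S euclidean (T f)"
    by (rule continuous_map_eq) (simp add: operator_off)
  then have "continuous_map X euclidean (T f)"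
    by (intro continuous_map_isolated_point [OF isolated isolated_closed]) auto
  then show ?thesis
    using isolated_in_space by (auto simp: cfun_space_def shift_operator_def)
qed

lemma operator_add: "T (f + g) = T f + T g"
  by (auto simp: shift_operator_def fun_eq_iff functional_add)

lemma operator_scale: "T (fun_scale c f) = fun_scale c (T f)"
  unfolding shift_operator_def functional_scale by (auto simp: fun_scale_def)

text \<open>Off \<open>p\<close> the operator only rearranges the values of \<open>f\<close>, and
  \<open>\<phi>\<close> already reaches every point of the space from there; the extra value at
  \<open>p\<close> cannot exceed the supremum by \<open>functional_norm\<close>.\<close>

lemma operator_norm:
  assumes f: "f \<in> cfun_space X"
  shows "sup_norm X (T f) = sup_norm X f"
proof (rule antisym)
  have "norm (T f x) \<le> sup_norm X f" if "x \<in> topspace X" for x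
  proof (cases "x = p")
    case True
    then show ?thesis by (simp add: operator_isolated functional_norm f)
  next
    case False
    then have "\<phi> x \<in> topspace X" using image_complement that by blast
    then show ?thesis
      using norm_le_sup_norm [OF compact f] operator_off that False by simp
  qed
  moreover have "topspace X \<noteq> {}"
    using isolated_in_space by blast
  ultimately show "sup_norm X (T f) \<le> sup_norm X f"
    unfolding sup_norm_def [of X "T f"] by (intro cSUP_least)
  have "norm (f x) \<le> sup_norm X (T f)" if x: "x \<in> topspace X" for x
  proof -
    obtain z where z: "z \<in> topspace X - {p}" "x = \<phi> z"
      using image_complement x by blast
    then show ?thesis
      using norm_le_sup_norm [OF compact operator_closed [OF f], of z] operator_off [of z f] by simp
  qed
  moreover have "topspace X \<noteq> {}"
    using isolated_in_space by blast
  ultimately show "sup_norm X f \<le> sup_norm X (T f)"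
    unfolding sup_norm_def [of X f] by (intro cSUP_least)
qed

text \<open>Composing \<open>f\<close> with the inverse of \<open>\<phi>\<close> prescribes
  everything except the value at \<open>p\<close>, which is the source of codimension 1.\<close>

lemma operator_preimage:
  assumes f: "f \<in> cfun_space X"
  shows "\<exists>w\<in>cfun_space X. \<forall>x\<in>topspace X - {p}. T w x = f x"
proof -
  let ?S = "subtopology X (topspace X - {p})"
  obtain \<psi> where "homeomorphic_maps ?S X \<phi> \<psi>"
    using homeo homeomorphic_map_maps by blast
  then have \<psi>: "continuous_map X ?S \<psi>" "\<And>x. x \<in> topspace X - {p} \<Longrightarrow> \<psi> (\<phi> x) = x"
    by (auto simp: homeomorphic_maps_def)
  let ?w = "\<lambda>x. if x \<in> topspace X then f (\<psi> x) else 0"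
  have "continuous_map ?S euclidean f"
    using f by (simp add: cfun_space_def continuous_map_from_subtopology)
  then have "continuous_map X euclidean (f \<circ> \<psi>)"
    using \<psi>(1) by (intro continuous_map_compose)
  then have "continuous_map X euclidean ?w"
    by (rule continuous_map_eq) simp
  then have "?w \<in> cfun_space X"
    by (simp add: cfun_space_def)
  moreover have "T ?w x = f x" if "x \<in> topspace X - {p}" for x
  proof -
    have "\<phi> x \<in> topspace X" using image_complement that by blast
    then show ?thesis using operator_off [OF that] \<psi>(2) [OF that] by simp
  qed
  ultimately show ?thesis by blast
qed

lemma operator_eq_0:
  assumes "f \<in> cfun_space X" and "\<And>x. x \<in> topspace X - {p} \<Longrightarrow> T f x = 0"
  shows "f = 0"
proof
  fix x
  show "f x = 0 x"
  proof (cases "x \<in> topspace X")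
    case True
    then obtain z where "z \<in> topspace X - {p}" "x = \<phi> z"
      using image_complement by blast
    then show ?thesis using assms(2) [of z] operator_off [of z f] by simp
  next
    case False
    then show ?thesis using assms(1) by (simp add: cfun_space_def)
  qed
qed

lemma operator_0: "T 0 = 0"
  using operator_scale [of 0 0] by (simp add: fun_scale_def zero_fun_def)

lemma operator_codim: "has_codim fun_scale (T ` cfun_space X) (cfun_space X) 1"
proof -
  interpret V: vector_space "fun_scale :: 'k \<Rightarrow> ('x \<Rightarrow> 'k) \<Rightarrow> 'x \<Rightarrow> 'k"
    by (rule vector_space_fun_scale)
  \<comment> \<open>The indicator of the isolated point spans the complement: a multiple of it in
    the range of \<open>T\<close> vanishes off \<open>p\<close>, so it is the image of 0, and any
    \<open>f\<close> differs from some \<open>T w\<close> only at \<open>p\<close>.\<close>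
  define e :: "'x \<Rightarrow> 'k" where "e = (\<lambda>x. if x = p then 1 else 0)"
  have "continuous_map (subtopology X (topspace X - {p})) euclidean e"
    by (rule continuous_map_eq [of _ _ "\<lambda>_. 0"]) (auto simp: e_def)
  then have "continuous_map X euclidean e"
    by (intro continuous_map_isolated_point [OF isolated isolated_closed]) auto
  then have e: "e \<in> cfun_space X"
    using isolated_in_space by (auto simp: cfun_space_def e_def)
  have "e p \<noteq> 0" by (simp add: e_def)
  then have "e \<noteq> 0" by auto
  have span: "V.span {e} = range (\<lambda>c. fun_scale c e)"
    by (simp add: V.span_singleton)
  have inter: "T ` cfun_space X \<inter> V.span {e} = {0}"
  proof (intro subset_antisym subsetI)
    fix v assume "v \<in> T ` cfun_space X \<inter> V.span {e}"
    then obtain f c where f: "f \<in> cfun_space X" "v = T f" "T f = fun_scale c e"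
      unfolding span by auto
    have "T f x = 0" if "x \<in> topspace X - {p}" for x
      unfolding f(3) using that by (simp add: fun_scale_def e_def)
    then have "f = 0" using f(1) operator_eq_0 by blast
    then show "v \<in> {0}" using f(2) operator_0 by simp
  next
    fix v :: "'x \<Rightarrow> 'k" assume "v \<in> {0}"
    then have "v = T 0" and "v = 0"
      by (simp_all only: singleton_iff operator_0)
    show "v \<in> T ` cfun_space X \<inter> V.span {e}"
    proof
      show "v \<in> T ` cfun_space X"
        using \<open>v = T 0\<close> zero_cfun_space by (rule image_eqI)
      show "v \<in> V.span {e}"
        unfolding \<open>v = 0\<close> by (rule V.span_zero)
    qed
  qed
  have decomp: "\<exists>w\<in>T ` cfun_space X. \<exists>b\<in>V.span {e}. f = w + b"
    if f: "f \<in> cfun_space X" for f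
  proof -
    obtain w where w: "w \<in> cfun_space X" "\<And>x. x \<in> topspace X - {p} \<Longrightarrow> T w x = f x"
      using operator_preimage [OF f] by blast
    have "f x = T w x + (f p - T w p) * e x" for x
    proof (cases "x \<in> topspace X")
      case True
      then show ?thesis using w(2) by (cases "x = p") (auto simp: e_def)
    next
      case False
      then show ?thesis
        using f operator_closed [OF w(1)] e by (simp add: cfun_space_def)
    qed
    then have "f = T w + fun_scale (f p - T w p) e"
      unfolding fun_scale_def plus_fun_def by (rule ext)
    moreover have "fun_scale (f p - T w p) e \<in> V.span {e}"
      unfolding span by blast
    ultimately show ?thesis using w(1) by blast
  qed
  have "\<not> V.dependent {e}"
    using \<open>e \<noteq> 0\<close> by simp
  moreover have "T ` cfun_space X \<subseteq> cfun_space X"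
    using operator_closed by blast
  moreover have "{e} \<subseteq> cfun_space X"
    using e by blast
  moreover have "finite {e} \<and> card {e} = 1"
    by simp
  moreover have "\<forall>f\<in>cfun_space X. \<exists>w\<in>T ` cfun_space X. \<exists>b\<in>V.span {e}. f = w + b"
    using decomp by (rule ballI)
  ultimately show ?thesis
    unfolding has_codim_def using inter
    by (intro conjI exI [of _ "{e}"]) (elim conjE, assumption)+
qed

lemma operator_iterate_0: "(T ^^ n) 0 = 0"
proof (induction n)
  case (Suc n)
  then show ?case by (simp only: funpow.simps comp_apply operator_0)
qed simp

text \<open>All shift properties but one hold for every operator of this form; only the triviality
  of the common range depends on the data.\<close>

lemma isometric_shift_operator:
  assumes "\<And>f. (\<And>n. n \<ge> 1 \<Longrightarrow> f \<in> (T ^^ n) ` cfun_space X) \<Longrightarrow> f = 0"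
  shows "isometric_shift_C X T"
proof -
  have "(\<Inter>n\<in>{1..}. (T ^^ n) ` cfun_space X) = {0}"
  proof (intro subset_antisym subsetI)
    fix f assume "f \<in> (\<Inter>n\<in>{1..}. (T ^^ n) ` cfun_space X)"
    then show "f \<in> {0}" using assms [of f] by simp
  next
    fix f :: "'x \<Rightarrow> 'k" assume "f \<in> {0}"
    then have "f = (T ^^ n) 0" for n
      by (simp only: singleton_iff operator_iterate_0)
    then show "f \<in> (\<Inter>n\<in>{1..}. (T ^^ n) ` cfun_space X)"
      using zero_cfun_space by blast
  qed
  then show ?thesis
    unfolding isometric_shift_C_def isometric_shift_def
    using compact Hausdorff operator_add operator_scale operator_norm operator_codim
    by (intro conjI Pi_I operator_closed ballI allI) assumption+
qed

lemma type_I_operator: "type_I X T"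
  unfolding type_I_def
  using isolated_in_space isolated homeo
  by (intro exI [of _ p] exI [of _ \<phi>] exI [of _ "\<lambda>_. 1"] conjI ballI)
    (simp_all only: operator_off continuous_map_const, simp_all)

end


subsection \<open>Dense orbits\<close>

locale dense_orbit =
  fixes Y :: "'y topology" and chi :: "'y \<Rightarrow> 'y" and oneY zeroY :: 'y and N :: nat
  assumes compact_Y: "compact_space Y" and Hausdorff_Y: "Hausdorff_space Y"
    and homeo_chi: "homeomorphic_map Y Y chi"
    and oneY: "oneY \<in> topspace Y"
    and dense: "Y closure_of {(chi ^^ n) oneY | n. n \<ge> 1} = topspace Y"
    and zeroY: "zeroY \<in> topspace Y"
    and N_pos: "N \<ge> 1" and periodic: "(chi ^^ N) zeroY = zeroY"
begin

lemma chi_image: "chi ` topspace Y = topspace Y"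
  using homeo_chi by (rule homeomorphic_imp_surjective_map)

lemma chi_inj: "inj_on chi (topspace Y)"
  using homeo_chi by (rule homeomorphic_imp_injective_map)

lemma continuous_chi_pow: "continuous_map Y Y (chi ^^ n)"
proof (induction n)
  case (Suc n)
  then show ?case
    using homeomorphic_imp_continuous_map [OF homeo_chi]
    unfolding funpow.simps by (rule continuous_map_compose)
qed (simp add: id_def)

lemma chi_pow_in: "y \<in> topspace Y \<Longrightarrow> (chi ^^ n) y \<in> topspace Y"
  using continuous_chi_pow [of n] by (auto simp: continuous_map_def)

lemma chi_pow_image: "(chi ^^ n) ` topspace Y = topspace Y"
proof (induction n)
  case (Suc n)
  then show ?case by (simp only: funpow.simps image_comp [symmetric] chi_image)
qed simp

lemma chi_pow_add: "(chi ^^ (m + n)) y = (chi ^^ m) ((chi ^^ n) y)"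
  by (simp add: funpow_add)

lemma zero_orbit_mult: "(chi ^^ (m + N * j)) zeroY = (chi ^^ m) zeroY"
  by (induction j) (simp_all add: chi_pow_add periodic add.assoc [symmetric] add.commute [of N])

lemma zero_orbit_mod: "(chi ^^ (n mod N)) zeroY = (chi ^^ n) zeroY"
  using zero_orbit_mult [of "n mod N" "n div N"] by simp

text \<open>A homeomorphism commutes with closure, so each application of \<open>chi\<close> drops
  the first point of the tail and preserves density.\<close>

lemma orbit_tail_dense: "Y closure_of {(chi ^^ n) oneY | n. n \<ge> Suc M} = topspace Y"
proof (induction M)
  case 0
  then show ?case using dense by simp
next
  case (Suc M)
  have eq: "{(chi ^^ n) oneY | n. n \<ge> Suc (Suc M)} = chi ` {(chi ^^ n) oneY | n. n \<ge> Suc M}"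
  proof (intro subset_antisym subsetI)
    fix y assume "y \<in> {(chi ^^ n) oneY | n. n \<ge> Suc (Suc M)}"
    then obtain n where n: "y = (chi ^^ n) oneY" "n \<ge> Suc (Suc M)"
      by blast
    then obtain m where "n = Suc m"
      by (cases n) auto
    then show "y \<in> chi ` {(chi ^^ n) oneY | n. n \<ge> Suc M}"
      using n by auto
  next
    fix y assume "y \<in> chi ` {(chi ^^ n) oneY | n. n \<ge> Suc M}"
    then obtain n where "y = (chi ^^ Suc n) oneY" "n \<ge> Suc M"
      by auto
    then show "y \<in> {(chi ^^ n) oneY | n. n \<ge> Suc (Suc M)}"
      by (intro CollectI exI [of _ "Suc n"]) simp
  qed
  have "{(chi ^^ n) oneY | n. n \<ge> Suc M} \<subseteq> topspace Y"
    using chi_pow_in oneY by auto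
  from homeomorphic_map_closure_of [OF homeo_chi this] show ?case
    unfolding eq Suc chi_image .
qed

lemma orbit_tail_closedin:
  assumes "closedin Y S" and "\<And>n. n > M \<Longrightarrow> (chi ^^ n) oneY \<in> S"
  shows "topspace Y \<subseteq> S"
proof -
  have "{(chi ^^ n) oneY | n. n \<ge> Suc M} \<subseteq> S"
    using assms(2) by auto
  from closure_of_minimal [OF this assms(1)] show ?thesis
    unfolding orbit_tail_dense .
qed

text \<open>For each \<open>e > 0\<close> the closed set where \<open>norm (h y)\<close> is at most
  \<open>e\<close> contains a tail of the orbit, hence all of \<open>Y\<close>.\<close>

lemma orbit_limit_zero:
  fixes h :: "'y \<Rightarrow> 'k::real_normed_vector"
  assumes h: "continuous_map Y euclidean h" and lim: "(\<lambda>n. h ((chi ^^ n) oneY)) \<longlonglongrightarrow> 0"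
    and y: "y \<in> topspace Y"
  shows "h y = 0"
proof -
  have "norm (h y) \<le> 0 + e" if "e > 0" for e
  proof -
    have "\<forall>\<^sub>F n in sequentially. norm (h ((chi ^^ n) oneY)) < e"
      using tendstoD [OF lim that] by simp
    then obtain M where M: "\<And>n. n \<ge> M \<Longrightarrow> norm (h ((chi ^^ n) oneY)) < e"
      by (auto simp: eventually_sequentially)
    have "closedin Y {y \<in> topspace Y. h y \<in> cball 0 e}"
      using h by (rule closedin_continuous_map_preimage) simp
    then have "topspace Y \<subseteq> {y \<in> topspace Y. h y \<in> cball 0 e}"
      by (rule orbit_tail_closedin [of _ M])
        (use M chi_pow_in oneY in \<open>auto simp: less_imp_le\<close>)
    then show ?thesis
      using y by auto
  qed
  then have "norm (h y) \<le> 0"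
    by (rule field_le_epsilon)
  then show ?thesis by simp
qed

lemma continuous_map_eq_0_closure:
  fixes h :: "'y \<Rightarrow> 'k::real_normed_vector"
  assumes "continuous_map Y euclidean h" and "\<And>x. x \<in> A \<Longrightarrow> h x = 0"
    and "A \<subseteq> topspace Y" and "y \<in> Y closure_of A"
  shows "h y = 0"
proof -
  have "closedin Y {y \<in> topspace Y. h y \<in> {0}}"
    using assms(1) by (rule closedin_continuous_map_preimage) simp
  then have "Y closure_of A \<subseteq> {y \<in> topspace Y. h y \<in> {0}}"
    by (rule closure_of_minimal [rotated]) (use assms in auto)
  then show ?thesis using assms(4) by blast
qed

text \<open>The residues modulo \<open>N\<close> cut the dense orbit into finitely many pieces, and
  closure commutes with finite unions.\<close>

lemma zero_in_residue_closure:
  obtains r where "zeroY \<in> Y closure_of {(chi ^^ n) oneY | n. n mod N = r}"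
proof -
  let ?A = "\<lambda>r. {(chi ^^ n) oneY | n. n mod N = r}"
  have "{(chi ^^ n) oneY | n. n \<ge> 1} \<subseteq> \<Union> (?A ` {..<N})"
    using N_pos mod_less_divisor [of N] by fastforce
  then have "zeroY \<in> Y closure_of (\<Union> (?A ` {..<N}))"
    using closure_of_mono dense zeroY by blast
  then have "zeroY \<in> (\<Union>S\<in>?A ` {..<N}. Y closure_of S)"
    by (simp only: closure_of_Union finite_imageI finite_lessThan)
  then show ?thesis using that by blast
qed

text \<open>A finite orbit is closed in a Hausdorff space, and this one is also dense.\<close>

lemma finite_if_periodic:
  assumes "(chi ^^ N) oneY = oneY"
  shows "finite (topspace Y)"
proof -
  have mult: "(chi ^^ (m + N * j)) oneY = (chi ^^ m) oneY" for m j
    by (induction j) (simp_all add: chi_pow_add assms add.assoc [symmetric] add.commute [of N])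
  have "(chi ^^ n) oneY \<in> (\<lambda>n. (chi ^^ n) oneY) ` {..<N}" for n
    using mult [of "n mod N" "n div N"] N_pos by (auto intro!: image_eqI [of _ _ "n mod N"])
  moreover have "closedin Y ((\<lambda>n. (chi ^^ n) oneY) ` {..<N})"
    using Hausdorff_Y chi_pow_in oneY by (intro closedin_Hausdorff_finite) auto
  ultimately have "topspace Y \<subseteq> (\<lambda>n. (chi ^^ n) oneY) ` {..<N}"
    by (intro orbit_tail_closedin [of _ 0])
  then show ?thesis by (rule finite_subset) simp
qed

text \<open>
  In the application, \<open>f\<close> and \<open>u\<close> are the restrictions to \<open>Y\<close> and to the discrete part of a
  function in the range of every power of the operator.
\<close>
lemma orbit_recurrence_zero:
  fixes f :: "'y \<Rightarrow> 'k::real_normed_field" and \<delta>\<^sub>1 \<delta>\<^sub>2 :: 'k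
  assumes f: "continuous_map Y euclidean f"
    and \<delta>: "\<delta>\<^sub>1 \<noteq> 0" "\<delta>\<^sub>2 \<noteq> 0" "(\<delta>\<^sub>1 + \<delta>\<^sub>2) ^ N \<noteq> 1"
    and u: "\<And>n. n \<ge> 1 \<Longrightarrow>
      u n = \<delta>\<^sub>1 * f ((chi ^^ n) oneY) + \<delta>\<^sub>2 * f ((chi ^^ (N + n)) oneY)"
    and lim: "(\<lambda>n. u n - f ((chi ^^ n) zeroY)) \<longlonglongrightarrow> 0"
    and y: "y \<in> topspace Y"
  shows "f y = 0"
proof -
  define c where "c n = f ((chi ^^ n) zeroY)" for n
  define g where "g y = \<delta>\<^sub>1 * f y + \<delta>\<^sub>2 * f ((chi ^^ N) y)" for y
  have f_pow: "continuous_map Y euclidean (\<lambda>y. f ((chi ^^ n) y))" for n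
    using continuous_map_compose [OF continuous_chi_pow f, of n] by (simp add: comp_def)
  have g: "continuous_map Y euclidean g"
    unfolding g_def using f f_pow
    by (intro continuous_map_add continuous_map_mult_left)
  have g_pow: "continuous_map Y euclidean (\<lambda>y. g ((chi ^^ n) y))" for n
    using continuous_map_compose [OF continuous_chi_pow g, of n] by (simp add: comp_def)
  have c_period: "c (m + N * j) = c m" for m j
    by (simp add: c_def zero_orbit_mult)
  have c_N: "c (N + n) = c n" for n
    using c_period [of n 1] by (simp add: add.commute)
  have lim_g: "(\<lambda>n. g ((chi ^^ n) oneY) - c n) \<longlonglongrightarrow> 0"
  proof (rule Lim_transform_eventually [OF lim])
    show "\<forall>\<^sub>F n in sequentially. u n - f ((chi ^^ n) zeroY) = g ((chi ^^ n) oneY) - c n"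
      using eventually_ge_at_top [of 1] by eventually_elim (simp add: u g_def c_def chi_pow_add)
  qed
  \<comment> \<open>Subtracting \<open>lim_g\<close> from its shift by \<open>N\<close> cancels the
    periodic terms \<open>c n\<close>, so a continuous function tends to 0 along the orbit.\<close>
  have g_N: "g ((chi ^^ N) y) = g y" if "y \<in> topspace Y" for y
  proof -
    have "(\<lambda>n. (g ((chi ^^ (n + N)) oneY) - c (n + N)) - (g ((chi ^^ n) oneY) - c n)) \<longlonglongrightarrow> 0 - 0"
      using lim_g by (intro tendsto_diff LIMSEQ_ignore_initial_segment [where k = N])
    then have "(\<lambda>n. g ((chi ^^ N) ((chi ^^ n) oneY)) - g ((chi ^^ n) oneY)) \<longlonglongrightarrow> 0"
      by (simp add: add.commute [of _ N] c_N chi_pow_add)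
    then have "g ((chi ^^ N) y) - g y = 0"
      by (intro orbit_limit_zero [OF _ _ that, of "\<lambda>y. g ((chi ^^ N) y) - g y"]
          continuous_map_diff g g_pow)
    then show ?thesis by simp
  qed
  \<comment> \<open>Along the indices \<open>n + N * j\<close> both terms of \<open>lim_g\<close>
    are independent of \<open>j\<close>, and a constant sequence with limit 0 is 0.\<close>
  have g_orbit: "g ((chi ^^ n) oneY) = c n" for n
  proof -
    have "g ((chi ^^ (n + N * j)) oneY) = g ((chi ^^ n) oneY)" for j
    proof (induction j)
      case (Suc j)
      have "n + N * Suc j = N + (n + N * j)" by simp
      then show ?case
        using Suc by (simp only: chi_pow_add [of N] g_N chi_pow_in oneY)
    qed simp
    moreover have "filterlim (\<lambda>j. n + N * j) sequentially sequentially"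
      using N_pos by (intro filterlim_subseq) (auto simp: strict_mono_def)
    then have "(\<lambda>j. g ((chi ^^ (n + N * j)) oneY) - c (n + N * j)) \<longlonglongrightarrow> 0"
      using lim_g by (rule filterlim_compose [rotated])
    ultimately have "(\<lambda>j::nat. g ((chi ^^ n) oneY) - c n) \<longlonglongrightarrow> 0"
      by (simp add: c_period)
    then show ?thesis
      by (simp add: LIMSEQ_const_iff)
  qed
  obtain r where r: "zeroY \<in> Y closure_of {(chi ^^ n) oneY | n. n mod N = r}"
    by (rule zero_in_residue_closure)
  let ?A = "{(chi ^^ n) oneY | n. n mod N = r}"
  have A: "?A \<subseteq> topspace Y"
    using chi_pow_in oneY by auto
  have c_mod: "c (n mod N + k) = c (n + k)" for n k
    using c_period [of "n mod N + k" "n div N"]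
    by (metis add.commute add.left_commute mod_mult_div_eq)
  \<comment> \<open>On \<open>?A\<close> the map \<open>y \<mapsto> g ((chi ^^ k) y)\<close> has the
    constant value \<open>c (r + k)\<close>, which persists at \<open>zeroY\<close> in the closure.
    There both summands of \<open>g\<close> see the same value \<open>c k\<close>.\<close>
  have rotate: "(\<delta>\<^sub>1 + \<delta>\<^sub>2) * c k = c (r + k)" for k
  proof -
    have "g ((chi ^^ k) zeroY) - c (r + k) = 0"
    proof (rule continuous_map_eq_0_closure [OF _ _ A r, of "\<lambda>y. g ((chi ^^ k) y) - c (r + k)"])
      show "continuous_map Y euclidean (\<lambda>y. g ((chi ^^ k) y) - c (r + k))"
        using g_pow by (intro continuous_map_diff) auto
      fix x assume "x \<in> ?A"
      then obtain n where "x = (chi ^^ n) oneY" "n mod N = r" by blast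
      then show "g ((chi ^^ k) x) - c (r + k) = 0"
        using g_orbit [of "k + n"] c_mod [of n k] by (simp add: chi_pow_add add.commute)
    qed
    moreover have "(chi ^^ N) ((chi ^^ k) zeroY) = (chi ^^ k) zeroY"
      using zero_orbit_mult [of k 1] by (simp add: chi_pow_add [symmetric] add.commute)
    ultimately show ?thesis
      by (simp add: g_def c_def algebra_simps)
  qed
  have "(\<delta>\<^sub>1 + \<delta>\<^sub>2) ^ j * c k = c (k + r * j)" for j k
  proof (induction j)
    case (Suc j)
    then show ?case
      using rotate [of "k + r * j"] by (simp add: algebra_simps)
  qed simp
  from this [of N] have "(\<delta>\<^sub>1 + \<delta>\<^sub>2) ^ N * c k = c k" for k
    using c_period [of k r] by (simp add: mult.commute)
  then have c_0: "c k = 0" for k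
    using \<delta>(3) by (metis mult_cancel_right1)
  have g_0: "g y = 0" if "y \<in> topspace Y" for y
    by (rule orbit_limit_zero [OF g _ that]) (simp add: g_orbit c_0)
  \<comment> \<open>Since \<open>g\<close> vanishes on \<open>Y\<close>, \<open>f\<close> after
    \<open>chi ^^ N\<close> is \<open>f\<close> times a scalar of this norm.\<close>
  define \<rho> where "\<rho> = norm \<delta>\<^sub>1 / norm \<delta>\<^sub>2"
  have f_N: "norm (f ((chi ^^ N) y)) = \<rho> * norm (f y)" if "y \<in> topspace Y" for y
  proof -
    have "\<delta>\<^sub>2 * f ((chi ^^ N) y) = - (\<delta>\<^sub>1 * f y)"
      using g_0 [OF that] by (simp add: g_def add_eq_0_iff)
    then have "norm \<delta>\<^sub>2 * norm (f ((chi ^^ N) y)) = norm \<delta>\<^sub>1 * norm (f y)"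
      by (metis norm_minus_cancel norm_mult)
    then show ?thesis
      using \<delta>(2) by (simp add: \<rho>_def field_simps)
  qed
  show ?thesis
  proof (cases "\<rho> = 1")
    case True
    have inv: "norm (f ((chi ^^ (n + N * j)) oneY)) = norm (f ((chi ^^ n) oneY))" for n j
    proof (induction j)
      case (Suc j)
      have "n + N * Suc j = N + (n + N * j)" by simp
      then show ?case
        using Suc f_N [of "(chi ^^ (n + N * j)) oneY"] True oneY
        by (simp only: chi_pow_add [of N] chi_pow_in)
    qed simp
    \<comment> \<open>By \<open>inv\<close>, the norm of \<open>f ((chi ^^ k) x)\<close> is the same
      for all \<open>x\<close> in \<open>?A\<close>; continuity carries this value to
      \<open>zeroY\<close>, where it is the norm of \<open>c k = 0\<close>.\<close>
    have tail: "f ((chi ^^ (r + k)) oneY) = 0" for k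
    proof -
      have "norm (f ((chi ^^ k) zeroY)) - norm (f ((chi ^^ (r + k)) oneY)) = 0"
      proof (rule continuous_map_eq_0_closure
          [OF _ _ A r, of "\<lambda>y. norm (f ((chi ^^ k) y)) - norm (f ((chi ^^ (r + k)) oneY))"])
        show "continuous_map Y euclidean
            (\<lambda>y. norm (f ((chi ^^ k) y)) - norm (f ((chi ^^ (r + k)) oneY)))"
          using f_pow by (intro continuous_map_diff continuous_map_norm) auto
        fix x assume "x \<in> ?A"
        then obtain n where n: "x = (chi ^^ n) oneY" "n mod N = r" by blast
        then have "k + n = (r + k) + N * (n div N)"
          by auto
        then show "norm (f ((chi ^^ k) x)) - norm (f ((chi ^^ (r + k)) oneY)) = 0"
          unfolding n(1) chi_pow_add [symmetric] by (simp only: inv diff_self)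
      qed
      then show ?thesis using c_0 [of k] by (simp add: c_def)
    qed
    have "\<forall>\<^sub>F n in sequentially. 0 = f ((chi ^^ n) oneY)"
      using eventually_ge_at_top [of r] by eventually_elim (metis tail le_add_diff_inverse)
    then have "(\<lambda>n. f ((chi ^^ n) oneY)) \<longlonglongrightarrow> 0"
      by (rule Lim_transform_eventually [OF tendsto_const])
    then show ?thesis
      by (rule orbit_limit_zero [OF f _ y])
  next
    case False
    have "compactin euclideanreal ((\<lambda>y. norm (f y)) ` topspace Y)"
      using compact_Y f by (intro image_compactin [of Y]) (auto simp: compact_space_def intro: continuous_map_norm)
    then have "compact ((\<lambda>y. norm (f y)) ` topspace Y)"
      by simp
    moreover have "(\<lambda>y. norm (f y)) ` topspace Y \<noteq> {}"
      using y by blast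
    ultimately obtain z where z: "z \<in> topspace Y" "\<And>y. y \<in> topspace Y \<Longrightarrow> norm (f y) \<le> norm (f z)"
      using compact_attains_sup [of "(\<lambda>y. norm (f y)) ` topspace Y"] by blast
    \<comment> \<open>The maximum point \<open>z\<close> is compared with its image and with a
      preimage under \<open>chi ^^ N\<close>; the two bounds force
      \<open>\<rho> * norm (f z) = norm (f z)\<close>.\<close>
    obtain x where x: "x \<in> topspace Y" "z = (chi ^^ N) x"
      using z(1) chi_pow_image by blast
    have \<rho>: "\<rho> \<ge> 0" by (simp add: \<rho>_def)
    have "\<rho> * norm (f z) \<le> norm (f z)"
      using z(2) [OF chi_pow_in [OF z(1), of N]] f_N [OF z(1)] by simp
    moreover have "norm (f z) \<le> \<rho> * norm (f z)"
      using f_N [OF x(1)] x(2) mult_left_mono [OF z(2) [OF x(1)] \<rho>] by simp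
    ultimately have "norm (f z) = 0"
      using False by simp
    then show ?thesis using z(2) [OF y] by simp
  qed
qed

end


subsection \<open>The glued space\<close>

text \<open>Compact subsets of a discrete space are the finite ones, so the neighbourhoods of
  \<open>None\<close> are cofinite.\<close>

lemma openin_Alexandroff_discrete:
  "openin (Alexandroff_compactification (discrete_topology A)) V \<longleftrightarrow>
     V \<subseteq> insert None (Some ` A) \<and> (None \<in> V \<longrightarrow> finite {a \<in> A. Some a \<notin> V})"
  (is "?L \<longleftrightarrow> ?R")
proof
  assume ?L
  then consider U where "U \<subseteq> A" "V = Some ` U"
    | C where "C \<subseteq> A" "finite C" "V = insert None (Some ` (A - C))"
    by (auto simp: openin_Alexandroff_compactification compactin_discrete_topology)
  then show ?R
  proof cases
    case 2
    then have "{a \<in> A. Some a \<notin> V} = C" by auto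
    then show ?thesis using 2 by auto
  qed auto
next
  assume R: ?R
  let ?U = "{a \<in> A. Some a \<in> V}" and ?C = "{a \<in> A. Some a \<notin> V}"
  show ?L
  proof (cases "None \<in> V")
    case True
    then have "V = insert None (Some ` (A - ?C))" using R by auto
    then show ?thesis
      using R True unfolding openin_Alexandroff_compactification
      by (intro disjI2 exI [of _ ?C]) (auto simp: compactin_discrete_topology)
  next
    case False
    then have "V = Some ` ?U" using R by auto
    then show ?thesis
      unfolding openin_Alexandroff_compactification
      by (intro disjI1 exI [of _ ?U]) auto
  qed
qed

context dense_orbit
begin

abbreviation X :: "('y + nat) topology" where
  "X \<equiv> shift_space Y chi zeroY N"

lemma topspace_shift_space: "topspace X = Inl ` topspace Y \<union> Inr ` {1..}"
proof (intro subset_antisym subsetI)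
  fix x assume "x \<in> topspace X"
  then show "x \<in> Inl ` topspace Y \<union> Inr ` {1..}"
    using chi_pow_in zeroY
    by (auto simp: shift_space_def glue_map_def residue_class_def split: option.splits)
next
  fix x :: "'y + nat" assume "x \<in> Inl ` topspace Y \<union> Inr ` {1..}"
  then consider y where "x = Inl y" "y \<in> topspace Y" | n where "x = Inr n" "n \<ge> 1"
    by auto
  then show "x \<in> topspace X"
  proof cases
    case 1
    then show ?thesis
      unfolding shift_space_def topspace_quotient_topology
      by (intro image_eqI [of _ _ "Inl y"]) (auto simp: glue_map_def)
  next
    case 2
    then show ?thesis
      unfolding shift_space_def topspace_quotient_topology using N_pos
      by (intro image_eqI [of _ _ "Inr (n mod N, Some n)"])
        (auto simp: glue_map_def residue_class_def)
  qed
qed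

lemma Inl_in_space [simp]: "Inl y \<in> topspace X \<longleftrightarrow> y \<in> topspace Y"
  by (auto simp: topspace_shift_space)

lemma Inr_in_space [simp]: "Inr n \<in> topspace X \<longleftrightarrow> n \<ge> 1"
  by (auto simp: topspace_shift_space)

text \<open>The point at infinity of class \<open>k\<close> is glued to
  \<open>(chi ^^ k) zeroY\<close>, and \<open>(chi ^^ n) zeroY\<close> depends only on
  \<open>n mod N\<close>. The \<open>N\<close> cofiniteness conditions therefore merge into a single
  eventual one, and residue classes disappear from later arguments.\<close>

lemma openin_shift_space:
  "openin X U \<longleftrightarrow> U \<subseteq> topspace X \<and> openin Y (Inl -` U) \<and>
     (\<forall>\<^sub>F n in sequentially. Inl ((chi ^^ n) zeroY) \<in> U \<longrightarrow> Inr n \<in> U)"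
proof (cases "U \<subseteq> topspace X")
  case True
  let ?sum = "sum_topology
    (\<lambda>k. Alexandroff_compactification (discrete_topology (residue_class N k))) {..<N}"
  let ?S = "binary_sum_topology Y ?sum"
  let ?P = "{x \<in> topspace ?S. glue_map chi zeroY x \<in> U}"
  \<comment> \<open>The exceptional points of class \<open>k\<close>; the set is empty unless the
    glued point at infinity lies in \<open>U\<close>.\<close>
  let ?B = "\<lambda>k. {n. Inl ((chi ^^ k) zeroY) \<in> U \<and> n \<in> residue_class N k \<and> Inr n \<notin> U}"
  have "openin X U \<longleftrightarrow> openin ?S ?P"
    using True by (simp add: shift_space_def openin_quotient_topology)
  also have "\<dots> \<longleftrightarrow> openin Y (Inl -` ?P) \<and> openin ?sum (Inr -` ?P)"
    by (rule openin_binary_sum_topology)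
  also have "Inl -` ?P = Inl -` U"
    using True by (auto simp: glue_map_def)
  also have "openin ?sum (Inr -` ?P) \<longleftrightarrow> (\<forall>k<N. finite (?B k))"
  proof -
    have "openin (Alexandroff_compactification (discrete_topology (residue_class N k)))
        {x. (k, x) \<in> Inr -` ?P} \<longleftrightarrow> finite (?B k)" if "k < N" for k
      using that by (auto simp: openin_Alexandroff_discrete glue_map_def elim: rev_finite_subset)
    moreover have "Inr -` ?P \<subseteq> Sigma {..<N}
        (topspace \<circ> (\<lambda>k. Alexandroff_compactification (discrete_topology (residue_class N k))))"
      by auto
    ultimately show ?thesis
      unfolding openin_sum_topology by auto
  qed
  also have "\<dots> \<longleftrightarrow> finite (\<Union>k<N. ?B k)"
    by auto
  \<comment> \<open>The index 0 names no point of the space; deleting it does not affect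
    finiteness.\<close>
  also have "(\<Union>k<N. ?B k) = {n. \<not> (Inl ((chi ^^ n) zeroY) \<in> U \<longrightarrow> Inr n \<in> U)} - {0}"
  proof (intro subset_antisym subsetI)
    fix n assume "n \<in> {n. \<not> (Inl ((chi ^^ n) zeroY) \<in> U \<longrightarrow> Inr n \<in> U)} - {0}"
    then have "n \<in> ?B (n mod N)"
      by (simp add: zero_orbit_mod residue_class_def)
    moreover have "n mod N < N" using N_pos by simp
    ultimately show "n \<in> (\<Union>k<N. ?B k)" by blast
  qed (auto simp: zero_orbit_mod residue_class_def)
  also have "finite \<dots> \<longleftrightarrow> (\<forall>\<^sub>F n in sequentially. Inl ((chi ^^ n) zeroY) \<in> U \<longrightarrow> Inr n \<in> U)"
    by (simp add: eventually_cofinite flip: cofinite_eq_sequentially)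
  finally show ?thesis using True by blast
next
  case False
  then show ?thesis using openin_subset by blast
qed

lemma openin_isolated: "n \<ge> 1 \<Longrightarrow> openin X {Inr n}"
  by (auto simp: openin_shift_space vimage_def)

lemma continuous_map_Inl: "continuous_map Y X Inl"
  unfolding continuous_map
proof (intro conjI allI impI)
  fix U assume "openin X U"
  then have "openin Y (Inl -` U)" "U \<subseteq> topspace X"
    by (auto simp: openin_shift_space)
  moreover have "{y \<in> topspace Y. Inl y \<in> U} = Inl -` U"
    using \<open>U \<subseteq> topspace X\<close> by auto
  ultimately show "openin Y {y \<in> topspace Y. Inl y \<in> U}" by simp
qed auto

text \<open>A continuous left inverse of \<open>Inl\<close>: each isolated point goes to the point
  of the periodic orbit that it shadows.\<close>

definition retraction :: "'y + nat \<Rightarrow> 'y" where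
  "retraction x = (case x of Inl y \<Rightarrow> y | Inr n \<Rightarrow> (chi ^^ n) zeroY)"

lemma continuous_map_retraction: "continuous_map X Y retraction"
  unfolding continuous_map
proof (intro conjI allI impI)
  show "retraction ` topspace X \<subseteq> topspace Y"
    using chi_pow_in zeroY by (auto simp: topspace_shift_space retraction_def)
  fix V assume V: "openin Y V"
  then have "Inl -` {x \<in> topspace X. retraction x \<in> V} = V"
    using openin_subset by (auto simp: retraction_def)
  moreover have "\<forall>\<^sub>F n in sequentially. Inl ((chi ^^ n) zeroY) \<in> {x \<in> topspace X. retraction x \<in> V} \<longrightarrow>
      Inr n \<in> {x \<in> topspace X. retraction x \<in> V}"
    using eventually_ge_at_top [of 1] by eventually_elim (auto simp: retraction_def)
  ultimately show "openin X {x \<in> topspace X. retraction x \<in> V}"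
    unfolding openin_shift_space using V by auto
qed

text \<open>A finite subfamily covering the copy of \<open>Y\<close> has an open union, which misses
  only finitely many isolated points.\<close>

lemma compact_shift_space: "compact_space X"
  unfolding compact_space_alt
proof (intro allI impI)
  fix \<U> assume \<U>: "(\<forall>U\<in>\<U>. openin X U) \<and> topspace X \<subseteq> \<Union> \<U>"
  have "compactin X (Inl ` topspace Y)"
    using compact_Y continuous_map_Inl by (auto simp: compact_space_def intro: image_compactin)
  moreover have "Inl ` topspace Y \<subseteq> \<Union> \<U>"
    using \<U> by auto
  ultimately obtain \<F> where \<F>: "finite \<F>" "\<F> \<subseteq> \<U>" "Inl ` topspace Y \<subseteq> \<Union> \<F>"
    using \<U> unfolding compactin_def by meson
  have "openin X (\<Union> \<F>)"
    using \<F>(2) \<U> by blast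
  then have "\<forall>\<^sub>F n in sequentially. Inl ((chi ^^ n) zeroY) \<in> \<Union> \<F> \<longrightarrow> Inr n \<in> \<Union> \<F>"
    unfolding openin_shift_space by blast
  moreover have "Inl ((chi ^^ n) zeroY) \<in> \<Union> \<F>" for n
    using \<F>(3) chi_pow_in [OF zeroY] by blast
  ultimately obtain M where M: "\<And>n. n \<ge> M \<Longrightarrow> Inr n \<in> \<Union> \<F>"
    by (auto simp: eventually_sequentially)
  have "compactin X (Inr ` {1..M})"
    by (intro finite_imp_compactin) auto
  moreover have "Inr ` {1..M} \<subseteq> \<Union> \<U>"
    using \<U> by (auto simp: subset_iff)
  ultimately obtain \<G> where \<G>: "finite \<G>" "\<G> \<subseteq> \<U>" "Inr ` {1..M} \<subseteq> \<Union> \<G>"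
    using \<U> unfolding compactin_def by meson
  have "x \<in> \<Union> (\<F> \<union> \<G>)" if x: "x \<in> topspace X" for x
  proof (cases x)
    case (Inl y)
    then have "x \<in> \<Union> \<F>" using x \<F>(3) by auto
    then show ?thesis by blast
  next
    case (Inr n)
    then have "x \<in> \<Union> \<F> \<or> x \<in> Inr ` {1..M}"
      using x M [of n] by (cases "n \<ge> M") auto
    then show ?thesis using \<G>(3) by blast
  qed
  then have "topspace X \<subseteq> \<Union> (\<F> \<union> \<G>)"
    by (rule subsetI)
  moreover have "finite (\<F> \<union> \<G>)" "\<F> \<union> \<G> \<subseteq> \<U>"
    using \<F>(1,2) \<G>(1,2) by simp_all
  ultimately show "\<exists>\<F>. finite \<F> \<and> \<F> \<subseteq> \<U> \<and> topspace X \<subseteq> \<Union> \<F>"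
    by blast
qed

lemma openin_complement_isolated: "openin X (topspace X - {Inr n})"
proof -
  have "\<forall>\<^sub>F m in sequentially. Inr m \<in> topspace X - {Inr n}"
    using eventually_gt_at_top [of n] by eventually_elim auto
  moreover have "Inl -` (topspace X - {Inr n}) = topspace Y"
    by auto
  ultimately show ?thesis
    unfolding openin_shift_space by (auto elim: eventually_mono)
qed

text \<open>Isolated points are also closed, and two points of \<open>Y\<close> are separated by
  preimages under \<open>retraction\<close>.\<close>

lemma Hausdorff_shift_space: "Hausdorff_space X"
  unfolding Hausdorff_space_def
proof (intro allI impI)
  fix x z assume xz: "x \<in> topspace X \<and> z \<in> topspace X \<and> x \<noteq> z"
  show "\<exists>U V. openin X U \<and> openin X V \<and> x \<in> U \<and> z \<in> V \<and> disjnt U V"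
  proof (cases "(\<exists>n. x = Inr n) \<or> (\<exists>n. z = Inr n)")
    case True
    have "\<exists>U V. openin X U \<and> openin X V \<and> x \<in> U \<and> z \<in> V \<and> disjnt U V" if "x = Inr n" for n
      using that xz openin_isolated [of n] openin_complement_isolated [of n]
      by (intro exI [of _ "{Inr n}"] exI [of _ "topspace X - {Inr n}"]) auto
    moreover have "\<exists>U V. openin X U \<and> openin X V \<and> x \<in> U \<and> z \<in> V \<and> disjnt U V" if "z = Inr n" for n
      using that xz openin_isolated [of n] openin_complement_isolated [of n]
      by (intro exI [of _ "{Inr n}"] exI [of _ "topspace X - {Inr n}"]) auto
    ultimately show ?thesis using True by blast
  next
    case False
    then obtain y w where yw: "x = Inl y" "z = Inl w"
      by (metis sum.exhaust)
    then have "y \<in> topspace Y" "w \<in> topspace Y" "y \<noteq> w"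
      using xz by auto
    then obtain U V where UV: "openin Y U" "openin Y V" "y \<in> U" "w \<in> V" "disjnt U V"
      using Hausdorff_Y unfolding Hausdorff_space_def by meson
    let ?E = "\<lambda>U. {x \<in> topspace X. retraction x \<in> U}"
    have "openin X (?E U)" "openin X (?E V)"
      using UV(1,2) continuous_map_retraction openin_continuous_map_preimage by blast+
    moreover have "x \<in> ?E U" "z \<in> ?E V"
      using xz UV(3,4) yw by (auto simp: retraction_def)
    moreover have "disjnt (?E U) (?E V)"
      using UV(5) by (auto simp: disjnt_iff)
    ultimately show ?thesis by blast
  qed
qed

text \<open>The difference of \<open>f\<close> and its values after \<open>retraction\<close> is
  continuous and vanishes on the copy of \<open>Y\<close>, so the open set where it is small
  contains almost all isolated points.\<close>

lemma cfun_space_limit: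
  assumes f: "f \<in> cfun_space X"
  shows "(\<lambda>n. f (Inr n) - f (Inl ((chi ^^ n) zeroY))) \<longlonglongrightarrow> 0"
proof (rule tendstoI)
  fix e :: real assume "e > 0"
  let ?g = "\<lambda>x. f x - f (Inl (retraction x))"
  have "continuous_map X euclidean (f \<circ> (Inl \<circ> retraction))"
    using f continuous_map_retraction continuous_map_Inl
    by (intro continuous_map_compose) (auto simp: cfun_space_def)
  then have "continuous_map X euclidean ?g"
    using f by (intro continuous_map_diff) (simp_all add: cfun_space_def comp_def)
  then have "openin X {x \<in> topspace X. ?g x \<in> ball 0 e}"
    by (rule openin_continuous_map_preimage) simp
  then have "\<forall>\<^sub>F n in sequentially. Inl ((chi ^^ n) zeroY) \<in> {x \<in> topspace X. ?g x \<in> ball 0 e} \<longrightarrow>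
      Inr n \<in> {x \<in> topspace X. ?g x \<in> ball 0 e}"
    unfolding openin_shift_space by blast
  then show "\<forall>\<^sub>F n in sequentially. dist (f (Inr n) - f (Inl ((chi ^^ n) zeroY))) 0 < e"
    by eventually_elim
      (use \<open>e > 0\<close> chi_pow_in zeroY in \<open>auto simp: retraction_def dist_norm norm_minus_commute\<close>)
qed


subsection \<open>The shift\<close>

lemma shift_map_chi: "y \<in> topspace Y \<Longrightarrow> shift_map Y chi (Inl (chi y)) = Inl y"
  by (simp add: shift_map_def chi_inj)

lemma shift_map_Suc: "shift_map Y chi (Inr (Suc n)) = Inr n"
  by (simp add: shift_map_def)

text \<open>Writing a point of \<open>Y\<close> as \<open>chi y\<close> replaces the inverse in
  \<open>shift_map\<close> by forward steps.\<close>

lemma space_cases [consumes 1, case_names Y isolated]: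
  assumes "x \<in> topspace X - {Inr 1}"
  obtains y where "x = Inl (chi y)" "y \<in> topspace Y" | n where "x = Inr (Suc n)" "n \<ge> 1"
proof (cases x)
  case (Inl z)
  then have "z \<in> chi ` topspace Y" using assms chi_image by simp
  then show ?thesis using that(1) Inl by blast
next
  case (Inr n)
  then show ?thesis using that(2) [of "n - 1"] assms by auto
qed

lemma shift_map_in: "x \<in> topspace X - {Inr 1} \<Longrightarrow> shift_map Y chi x \<in> topspace X"
  by (erule space_cases) (simp_all add: shift_map_chi shift_map_Suc)

text \<open>By \<open>openin_shift_space\<close>, continuity and openness split into the
  homeomorphism property of \<open>chi\<close> on \<open>Y\<close> and an index shift by one in the
  eventual condition.\<close>

lemma homeomorphic_shift_map:
  "homeomorphic_map (subtopology X (topspace X - {Inr 1})) X (shift_map Y chi)"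
proof (rule bijective_open_imp_homeomorphic_map)
  let ?S = "subtopology X (topspace X - {Inr 1})" and ?\<phi> = "shift_map Y chi"
  have S: "topspace ?S = topspace X - {Inr 1}" by auto
  have openin_S: "openin ?S U \<longleftrightarrow> openin X U \<and> U \<subseteq> topspace X - {Inr 1}" for U
    using openin_complement_isolated by (rule openin_open_subtopology)
  show "inj_on ?\<phi> (topspace ?S)"
    unfolding S
  proof (rule inj_onI)
    fix x z
    assume "x \<in> topspace X - {Inr 1}" "z \<in> topspace X - {Inr 1}" "?\<phi> x = ?\<phi> z"
    then show "x = z"
      by (elim space_cases) (auto simp: shift_map_chi shift_map_Suc)
  qed
  show "?\<phi> ` topspace ?S = topspace X"
    unfolding S
  proof (intro subset_antisym subsetI)
    fix x assume "x \<in> topspace X"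
    then consider y where "x = Inl y" "y \<in> topspace Y" | n where "x = Inr n" "n \<ge> 1"
      by (cases x) auto
    then show "x \<in> ?\<phi> ` (topspace X - {Inr 1})"
    proof cases
      case 1
      then show ?thesis
        using chi_pow_in [of y 1] by (intro image_eqI [of _ _ "Inl (chi y)"]) (auto simp: shift_map_chi)
    next
      case 2
      then show ?thesis
        by (intro image_eqI [of _ _ "Inr (Suc n)"]) (auto simp: shift_map_Suc)
    qed
  qed (use shift_map_in in blast)
  show "continuous_map ?S X ?\<phi>"
    unfolding continuous_map
  proof (intro conjI allI impI)
    show "?\<phi> ` topspace ?S \<subseteq> topspace X"
      unfolding S using shift_map_in by blast
    fix U assume U: "openin X U"
    let ?P = "{x \<in> topspace X - {Inr 1}. ?\<phi> x \<in> U}"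
    have "Inl -` ?P = chi ` (Inl -` U)"
    proof (intro subset_antisym subsetI)
      fix z assume z: "z \<in> Inl -` ?P"
      then have "z \<in> chi ` topspace Y" using chi_image by auto
      then show "z \<in> chi ` (Inl -` U)" using z by (auto simp: shift_map_chi)
    next
      fix z assume "z \<in> chi ` (Inl -` U)"
      moreover have "Inl -` U \<subseteq> topspace Y" using U openin_subset by fastforce
      ultimately show "z \<in> Inl -` ?P"
        using chi_image by (auto simp: shift_map_chi)
    qed
    moreover have "openin Y (chi ` (Inl -` U))"
      using U homeomorphic_imp_open_map [OF homeo_chi] by (auto simp: open_map_def openin_shift_space)
    moreover have "\<forall>\<^sub>F n in sequentially. Inl ((chi ^^ n) zeroY) \<in> ?P \<longrightarrow> Inr n \<in> ?P"
    proof -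
      have "\<forall>\<^sub>F n in sequentially. Inl ((chi ^^ n) zeroY) \<in> U \<longrightarrow> Inr n \<in> U"
        using U unfolding openin_shift_space by blast
      then have "\<forall>\<^sub>F n in sequentially. Inl ((chi ^^ Suc n) zeroY) \<in> ?P \<longrightarrow> Inr (Suc n) \<in> ?P"
        using eventually_ge_at_top [of 1]
        by eventually_elim (use chi_pow_in zeroY in \<open>auto simp: shift_map_chi shift_map_Suc\<close>)
      then show ?thesis
        by (subst (asm) eventually_sequentially_Suc)
    qed
    ultimately have "openin X ?P"
      unfolding openin_shift_space by auto
    then show "openin ?S {x \<in> topspace ?S. ?\<phi> x \<in> U}"
      unfolding S openin_S by blast
  qed
  show "open_map ?S X ?\<phi>"
    unfolding open_map_def
  proof (intro allI impI)
    fix U assume "openin ?S U"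
    then have U: "openin X U" "U \<subseteq> topspace X - {Inr 1}"
      unfolding openin_S by auto
    have "Inl -` (?\<phi> ` U) = {y \<in> topspace Y. chi y \<in> Inl -` U}"
    proof (intro subset_antisym subsetI)
      fix y assume "y \<in> Inl -` (?\<phi> ` U)"
      then obtain x where x: "x \<in> U" "?\<phi> x = Inl y" by auto
      then have "x \<in> topspace X - {Inr 1}" using U(2) by blast
      then show "y \<in> {y \<in> topspace Y. chi y \<in> Inl -` U}"
        using x by (cases rule: space_cases) (auto simp: shift_map_chi shift_map_Suc)
    next
      fix y assume "y \<in> {y \<in> topspace Y. chi y \<in> Inl -` U}"
      then show "y \<in> Inl -` (?\<phi> ` U)"
        by (auto intro!: image_eqI [of _ _ "Inl (chi y)"] simp: shift_map_chi)
    qed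
    moreover have "openin Y {y \<in> topspace Y. chi y \<in> Inl -` U}"
      using U(1) homeomorphic_imp_continuous_map [OF homeo_chi]
      by (intro openin_continuous_map_preimage) (auto simp: openin_shift_space)
    moreover have "\<forall>\<^sub>F n in sequentially. Inl ((chi ^^ n) zeroY) \<in> ?\<phi> ` U \<longrightarrow> Inr n \<in> ?\<phi> ` U"
    proof -
      have "\<forall>\<^sub>F n in sequentially. Inl ((chi ^^ Suc n) zeroY) \<in> U \<longrightarrow> Inr (Suc n) \<in> U"
        using U(1) unfolding openin_shift_space
        by (subst eventually_sequentially_Suc) blast
      then show ?thesis
      proof eventually_elim
        case (elim n)
        show ?case
        proof
          assume "Inl ((chi ^^ n) zeroY) \<in> ?\<phi> ` U"
          then obtain x where x: "x \<in> U" "?\<phi> x = Inl ((chi ^^ n) zeroY)" by auto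
          then have "x \<in> topspace X - {Inr 1}" using U(2) by blast
          then have "x = Inl ((chi ^^ Suc n) zeroY)"
            using x(2) by (cases rule: space_cases) (auto simp: shift_map_chi shift_map_Suc)
          then have "Inr (Suc n) \<in> U" using elim x(1) by simp
          then show "Inr n \<in> ?\<phi> ` U"
            by (intro image_eqI [of _ _ "Inr (Suc n)"]) (simp_all add: shift_map_Suc)
        qed
      qed
    qed
    moreover have "?\<phi> ` U \<subseteq> topspace X"
      using U(2) shift_map_in by blast
    ultimately show "openin X (?\<phi> ` U)"
      unfolding openin_shift_space by simp
  qed
qed

abbreviation shift ::
    "'k::real_normed_field \<Rightarrow> 'k \<Rightarrow> ('y + nat \<Rightarrow> 'k) \<Rightarrow> 'y + nat \<Rightarrow> 'k" where
  "shift \<delta>\<^sub>1 \<delta>\<^sub>2 \<equiv> shift_operator X (Inr 1) (\<lambda>_. 1) (shift_map Y chi)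
     (shift_functional chi oneY N \<delta>\<^sub>1 \<delta>\<^sub>2)"

lemma isolated_point_shift_shift:
  fixes \<delta>\<^sub>1 \<delta>\<^sub>2 :: "'k::real_normed_field"
  assumes "norm \<delta>\<^sub>1 + norm \<delta>\<^sub>2 \<le> 1"
  shows "isolated_point_shift X (Inr 1) (shift_map Y chi) (shift_functional chi oneY N \<delta>\<^sub>1 \<delta>\<^sub>2)"
proof
  show "compact_space X" "Hausdorff_space X" "openin X {Inr 1}"
    "homeomorphic_map (subtopology X (topspace X - {Inr 1})) X (shift_map Y chi)"
    using compact_shift_space Hausdorff_shift_space openin_isolated homeomorphic_shift_map by auto
  fix f g :: "'y + nat \<Rightarrow> 'k" and c
  let ?\<Delta> = "shift_functional chi oneY N \<delta>\<^sub>1 \<delta>\<^sub>2"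
  show "?\<Delta> (f + g) = ?\<Delta> f + ?\<Delta> g"
    by (simp add: shift_functional_def algebra_simps)
  show "?\<Delta> (fun_scale c f) = c * ?\<Delta> f"
    by (simp add: shift_functional_def fun_scale_def algebra_simps)
  assume f: "f \<in> cfun_space X"
  let ?s = "sup_norm X f"
  have 1: "norm (f (Inl oneY)) \<le> ?s" and 2: "norm (f (Inl ((chi ^^ N) oneY))) \<le> ?s"
    using oneY chi_pow_in by (auto intro!: norm_le_sup_norm [OF compact_shift_space f])
  have "norm (?\<Delta> f) \<le> norm \<delta>\<^sub>1 * norm (f (Inl oneY)) + norm \<delta>\<^sub>2 * norm (f (Inl ((chi ^^ N) oneY)))"
    unfolding shift_functional_def by (metis norm_mult norm_triangle_ineq)
  also have "\<dots> \<le> norm \<delta>\<^sub>1 * ?s + norm \<delta>\<^sub>2 * ?s"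
    using 1 2 by (intro add_mono mult_left_mono) auto
  also have "\<dots> = (norm \<delta>\<^sub>1 + norm \<delta>\<^sub>2) * ?s"
    by (simp add: algebra_simps)
  also have "\<dots> \<le> 1 * ?s"
    using assms order_trans [OF norm_ge_zero 1] by (intro mult_right_mono)
  finally show "norm (?\<Delta> f) \<le> ?s" by simp
qed

section \<open>Iterates of the shift and their common range\<close>

lemma shift_isolated:
  "shift \<delta>\<^sub>1 \<delta>\<^sub>2 f (Inr 1) = \<delta>\<^sub>1 * f (Inl oneY) + \<delta>\<^sub>2 * f (Inl ((chi ^^ N) oneY))"
  by (simp add: shift_operator_def shift_functional_def)

lemma shift_iterate_Inl:
  assumes "y \<in> topspace Y"
  shows "(shift \<delta>\<^sub>1 \<delta>\<^sub>2 ^^ n) f (Inl ((chi ^^ n) y)) = f (Inl y)"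
proof (induction n)
  case (Suc n)
  have "shift \<delta>\<^sub>1 \<delta>\<^sub>2 g (Inl (chi z)) = g (Inl z)" if "z \<in> topspace Y" for z g
    using that chi_image by (auto simp: shift_operator_def shift_map_chi)
  then show ?case
    using Suc chi_pow_in [OF assms, of n] by (simp only: funpow.simps comp_apply)
qed simp

lemma shift_iterate_Inr:
  assumes "m \<ge> 1"
  shows "(shift \<delta>\<^sub>1 \<delta>\<^sub>2 ^^ n) f (Inr (m + n)) = f (Inr m)"
proof (induction n)
  case (Suc n)
  have "shift \<delta>\<^sub>1 \<delta>\<^sub>2 g (Inr (Suc k)) = g (Inr k)" if "k \<ge> 1" for k g
    using that by (auto simp: shift_operator_def shift_map_Suc)
  then show ?case
    using Suc assms by (simp only: funpow.simps comp_apply add_Suc_right trans_le_add1)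
qed simp

text \<open>From \<open>n\<close>, \<open>n - 1\<close> backward steps reach the point 1, where the
  last application evaluates the functional at \<open>h\<close>; on \<open>Y\<close>,
  \<open>h\<close> equals \<open>f\<close> read \<open>n\<close> steps further along
  \<open>chi\<close>.\<close>

lemma shift_iterate_value:
  assumes "n \<ge> 1" and "f = (shift \<delta>\<^sub>1 \<delta>\<^sub>2 ^^ n) h"
  shows "f (Inr n) = \<delta>\<^sub>1 * f (Inl ((chi ^^ n) oneY)) + \<delta>\<^sub>2 * f (Inl ((chi ^^ (N + n)) oneY))"
proof -
  obtain j where j: "n = Suc j"
    using assms(1) by (cases n) auto
  have "f (Inr n) = (shift \<delta>\<^sub>1 \<delta>\<^sub>2 ^^ j) (shift \<delta>\<^sub>1 \<delta>\<^sub>2 h) (Inr (1 + j))"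
    unfolding assms(2) j funpow_Suc_right by simp
  also have "\<dots> = shift \<delta>\<^sub>1 \<delta>\<^sub>2 h (Inr 1)"
    by (rule shift_iterate_Inr) simp
  also have "h (Inl oneY) = f (Inl ((chi ^^ n) oneY))"
    unfolding assms(2) using oneY by (rule shift_iterate_Inl [symmetric])
  then have "shift \<delta>\<^sub>1 \<delta>\<^sub>2 h (Inr 1) =
      \<delta>\<^sub>1 * f (Inl ((chi ^^ n) oneY)) + \<delta>\<^sub>2 * h (Inl ((chi ^^ N) oneY))"
    unfolding shift_isolated by simp
  also have "h (Inl ((chi ^^ N) oneY)) = f (Inl ((chi ^^ (N + n)) oneY))"
    unfolding assms(2) add.commute [of N] chi_pow_add
    by (rule shift_iterate_Inl [symmetric]) (simp add: chi_pow_in oneY)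
  finally show ?thesis .
qed

text \<open>\<open>orbit_recurrence_zero\<close> kills \<open>f\<close> on \<open>Y\<close>; the
  values at isolated points are combinations of values on \<open>Y\<close>.\<close>

lemma shift_range_Inter:
  fixes \<delta>\<^sub>1 \<delta>\<^sub>2 :: "'k::real_normed_field"
  assumes \<delta>: "\<delta>\<^sub>1 \<noteq> 0" "\<delta>\<^sub>2 \<noteq> 0" "norm \<delta>\<^sub>1 + norm \<delta>\<^sub>2 \<le> 1" "(\<delta>\<^sub>1 + \<delta>\<^sub>2) ^ N \<noteq> 1"
    and in_ranges: "\<And>n. n \<ge> 1 \<Longrightarrow> f \<in> (shift \<delta>\<^sub>1 \<delta>\<^sub>2 ^^ n) ` cfun_space X"
  shows "f = 0"
proof -
  interpret isolated_point_shift X "Inr 1" "shift_map Y chi" "shift_functional chi oneY N \<delta>\<^sub>1 \<delta>\<^sub>2"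
    using \<delta>(3) by (rule isolated_point_shift_shift)
  have f: "f \<in> cfun_space X"
    using in_ranges [of 1] operator_closed by auto
  have isolated_value: "f (Inr n) = \<delta>\<^sub>1 * f (Inl ((chi ^^ n) oneY)) + \<delta>\<^sub>2 * f (Inl ((chi ^^ (N + n)) oneY))"
    if "n \<ge> 1" for n
    using in_ranges [OF that] shift_iterate_value [OF that] by blast
  have "continuous_map Y euclidean (f \<circ> Inl)"
    using continuous_map_Inl f by (intro continuous_map_compose) (auto simp: cfun_space_def)
  then have Y: "f (Inl y) = 0" if "y \<in> topspace Y" for y
    using orbit_recurrence_zero [of "\<lambda>y. f (Inl y)" \<delta>\<^sub>1 \<delta>\<^sub>2 "\<lambda>n. f (Inr n)" y]
      \<delta>(1,2,4) isolated_value cfun_space_limit [OF f] that by (simp add: comp_def)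
  have "f (Inr n) = 0" if "n \<ge> 1" for n
    using isolated_value [OF that] Y chi_pow_in oneY by simp
  then have "f x = 0" if "x \<in> topspace X" for x
    using Y that by (cases x) auto
  then have "f x = 0" for x
    using f by (cases "x \<in> topspace X") (simp_all add: cfun_space_def)
  then show ?thesis by (intro ext) simp
qed

text \<open>Type II would give the functional the absolute value of one point evaluation, at
  \<open>z\<close>. The constant 1 yields
  \<open>norm (\<delta>\<^sub>1 + \<delta>\<^sub>2) = 1\<close>, so \<open>Y\<close> is infinite and
  the two evaluation points differ. A function vanishing at \<open>z\<close> and at exactly one of
  them is then contradictory.\<close>

lemma not_type_II_shift:
  fixes \<delta>\<^sub>1 \<delta>\<^sub>2 :: "'k::real_normed_field"
  assumes \<delta>: "\<delta>\<^sub>1 \<noteq> 0" "\<delta>\<^sub>2 \<noteq> 0" and inf: "norm (\<delta>\<^sub>1 + \<delta>\<^sub>2) = 1 \<Longrightarrow> infinite (topspace Y)"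
  shows "\<not> type_II X (shift \<delta>\<^sub>1 \<delta>\<^sub>2)"
proof
  assume "type_II X (shift \<delta>\<^sub>1 \<delta>\<^sub>2)"
  then obtain \<psi> a where \<psi>: "continuous_map X X \<psi>"
    and a: "\<And>x. x \<in> topspace X \<Longrightarrow> norm (a x :: 'k) = 1"
    and T: "\<And>f x. f \<in> cfun_space X \<Longrightarrow> x \<in> topspace X \<Longrightarrow> shift \<delta>\<^sub>1 \<delta>\<^sub>2 f x = a x * f (\<psi> x)"
    unfolding type_II_def by blast
  define z where "z = \<psi> (Inr 1)"
  have one: "Inr 1 \<in> topspace X" by simp
  have z: "z \<in> topspace X"
    unfolding z_def using \<psi> one by (auto simp: continuous_map_def)
  have eq: "norm (\<delta>\<^sub>1 * f (Inl oneY) + \<delta>\<^sub>2 * f (Inl ((chi ^^ N) oneY))) = norm (f z)"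
    if "f \<in> cfun_space X" for f
    using T [OF that one] a [OF one] unfolding shift_isolated z_def by (simp add: norm_mult)
  let ?x = "Inl oneY :: 'y + nat" and ?y = "Inl ((chi ^^ N) oneY) :: 'y + nat"
  have xy: "?x \<in> topspace X" "?y \<in> topspace X"
    using oneY chi_pow_in by simp_all
  let ?u = "\<lambda>x. if x \<in> topspace X then 1 else 0 :: 'k"
  have "continuous_map X euclidean ?u"
    by (rule continuous_map_eq [of _ _ "\<lambda>_. 1"]) auto
  then have "?u \<in> cfun_space X"
    by (simp add: cfun_space_def)
  from eq [OF this] have "norm (\<delta>\<^sub>1 + \<delta>\<^sub>2) = 1"
    using xy z by simp
  then have "?x \<noteq> ?y"
    using inf finite_if_periodic by auto
  note separate = cfun_space_separate [OF compact_shift_space Hausdorff_shift_space]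
  show False
  proof (cases "z = ?x")
    case True
    obtain f :: "'y + nat \<Rightarrow> 'k" where "f \<in> cfun_space X" "f ?y = 1" "f ?x = 0"
      using separate [of "{?x}" ?y] xy \<open>?x \<noteq> ?y\<close> by auto
    then show ?thesis using eq [of f] True \<delta> by simp
  next
    case False
    obtain f :: "'y + nat \<Rightarrow> 'k" where "f \<in> cfun_space X" "f ?x = 1" "f ?y = 0" "f z = 0"
      using separate [of "{?y, z}" ?x] xy z \<open>?x \<noteq> ?y\<close> False by auto
    then show ?thesis using eq [of f] \<delta> by simp
  qed
qed

text \<open>The proviso for type I_0 excludes a genuine exception. If \<open>Y\<close> is finite, it
  is a single cycle on which \<open>chi ^^ N\<close> is the identity, so the functional is
  \<open>\<delta>\<^sub>1 + \<delta>\<^sub>2\<close> times the evaluation at \<open>oneY\<close>.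
  When that factor has norm 1, the operator is of type II as well.\<close>

lemma shift_type_I0:
  fixes \<delta>\<^sub>1 \<delta>\<^sub>2 :: "'k::real_normed_field"
  assumes "\<delta>\<^sub>1 \<noteq> 0" and "\<delta>\<^sub>2 \<noteq> 0" and "norm \<delta>\<^sub>1 + norm \<delta>\<^sub>2 \<le> 1" and "(\<delta>\<^sub>1 + \<delta>\<^sub>2) ^ N \<noteq> 1"
  shows "isometric_shift_C X (shift \<delta>\<^sub>1 \<delta>\<^sub>2) \<and> type_I X (shift \<delta>\<^sub>1 \<delta>\<^sub>2) \<and>
    ((norm (\<delta>\<^sub>1 + \<delta>\<^sub>2) = 1 \<longrightarrow> infinite (topspace Y)) \<longrightarrow>
      isometric_shift_type_I0 X (shift \<delta>\<^sub>1 \<delta>\<^sub>2))"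
proof -
  interpret isolated_point_shift X "Inr 1" "shift_map Y chi" "shift_functional chi oneY N \<delta>\<^sub>1 \<delta>\<^sub>2"
    using assms(3) by (rule isolated_point_shift_shift)
  have "isometric_shift_C X (shift \<delta>\<^sub>1 \<delta>\<^sub>2)"
    by (rule isometric_shift_operator) (rule shift_range_Inter [OF assms])
  then show ?thesis
    unfolding isometric_shift_type_I0_def
    using type_I_operator not_type_II_shift [OF assms(1,2)] by blast
qed

end

text \<open>The two conjuncts are the two choices of scalar field, both instances of
  \<open>shift_type_I0\<close>; the proviso on type I_0 is the one explained there.\<close>

theorem theorem9p2:
  fixes Y :: "'y topology" and chi :: "'y \<Rightarrow> 'y" and oneY zeroY :: 'y and N :: nat
  assumes "compact_space Y" and "Hausdorff_space Y"
    and "homeomorphic_map Y Y chi"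
    and "oneY \<in> topspace Y"
    and "Y closure_of {(chi ^^ n) oneY | n. n \<ge> 1} = topspace Y"
    and "zeroY \<in> topspace Y - {oneY}"
    and "N \<ge> 1" and "(chi ^^ N) zeroY = zeroY"
    and "\<And>m. 1 \<le> m \<Longrightarrow> m < N \<Longrightarrow> (chi ^^ m) zeroY \<noteq> zeroY"
  shows
    "(\<forall>\<delta>\<^sub>1 \<delta>\<^sub>2 :: real.
        \<delta>\<^sub>1 \<noteq> 0 \<longrightarrow> \<delta>\<^sub>2 \<noteq> 0 \<longrightarrow> norm \<delta>\<^sub>1 + norm \<delta>\<^sub>2 \<le> 1 \<longrightarrow> (\<delta>\<^sub>1 + \<delta>\<^sub>2) ^ N \<noteq> 1 \<longrightarrow>
        (let X = shift_space Y chi zeroY N;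
             T = shift_operator X (Inr 1) (\<lambda>_. 1) (shift_map Y chi)
                   (shift_functional chi oneY N \<delta>\<^sub>1 \<delta>\<^sub>2)
         in isometric_shift_C X T \<and> type_I X T \<and>
            ((norm (\<delta>\<^sub>1 + \<delta>\<^sub>2) = 1 \<longrightarrow> infinite (topspace Y)) \<longrightarrow>
               isometric_shift_type_I0 X T)))
   \<and> (\<forall>\<delta>\<^sub>1 \<delta>\<^sub>2 :: complex.
        \<delta>\<^sub>1 \<noteq> 0 \<longrightarrow> \<delta>\<^sub>2 \<noteq> 0 \<longrightarrow> norm \<delta>\<^sub>1 + norm \<delta>\<^sub>2 \<le> 1 \<longrightarrow> (\<delta>\<^sub>1 + \<delta>\<^sub>2) ^ N \<noteq> 1 \<longrightarrow>
        (let X = shift_space Y chi zeroY N;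
             T = shift_operator X (Inr 1) (\<lambda>_. 1) (shift_map Y chi)
                   (shift_functional chi oneY N \<delta>\<^sub>1 \<delta>\<^sub>2)
         in isometric_shift_C X T \<and> type_I X T \<and>
            ((norm (\<delta>\<^sub>1 + \<delta>\<^sub>2) = 1 \<longrightarrow> infinite (topspace Y)) \<longrightarrow>
               isometric_shift_type_I0 X T)))"
proof -
  interpret dense_orbit Y chi oneY zeroY N
    using assms by unfold_locales auto
  show ?thesis
    unfolding Let_def by (intro conjI allI impI) (blast dest: shift_type_I0)+
qed

end
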